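(* Let $\sigma_{\widehat{\mathrm{mex}}}(n)$ denote the sum of $\widehat{\mathrm{mex}}(\pi)$ over all overpartitions $\pi$ of $n$ (for $n\ge1$), with $\sigma_{\widehat{\mathrm{mex}}}(0)=1$. Then \[\lim_{X\to+\infty}\frac{\#\{n\le X:\ \sigma_{\widehat{\mathrm{mex}}}(n)\equiv 0 \pmod 2\}}{X}=1.\]
   Context: An overpartition of a positive integer $n$ is a non-increasing sequence of positive integers summing to $n$ in which the first occurrence of each number may (or may not) be overlined. For an overpartition $\pi$, $\widehat{\mathrm{mex}}(\pi)$ is the smallest positive integer that does not occur as an overlined part of $\pi$. Here $n$ ranges over nonnegative integers. *)

theory Defs
  imports Complex_Main "HOL-Number_Theory.Cong"
begin

(* A part is a pair (m, b): m is its size, and b records whether it is overlined.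
   The last conjunct says that only the first occurrence of each size may be overlined. *)
definition overpartitions :: "nat \<Rightarrow> (nat \<times> bool) list set" where
  "overpartitions n = {\<pi>.
     (\<forall>p\<in>set \<pi>. fst p > 0) \<and>
     sorted_wrt (\<lambda>p q. fst p \<ge> fst q) \<pi> \<and>
     sum_list (map fst \<pi>) = n \<and>
     (\<forall>i j. i < j \<and> j < length \<pi> \<and> fst (\<pi> ! i) = fst (\<pi> ! j) \<longrightarrow> \<not> snd (\<pi> ! j))}"

definition mex_hat :: "(nat \<times> bool) list \<Rightarrow> nat" where
  "mex_hat \<pi> = (LEAST m. m > 0 \<and> (m, True) \<notin> set \<pi>)"

definition sigma_mex_hat :: "nat \<Rightarrow> nat" where
  "sigma_mex_hat n = (if n = 0 then 1 else (\<Sum>\<pi>\<in>overpartitions n. mex_hat \<pi>))"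

(* The sum in sigma_mex_hat is over a finite set, so it is not 0 by convention. *)
lemma finite_overpartitions: "finite (overpartitions n)"
proof (rule finite_subset)
  show "overpartitions n \<subseteq> {\<pi>. set \<pi> \<subseteq> {..n} \<times> UNIV \<and> length \<pi> \<le> n}"
  proof
    fix \<pi> assume "\<pi> \<in> overpartitions n"
    then have pos: "\<forall>p\<in>set \<pi>. fst p > 0" and s: "sum_list (map fst \<pi>) = n"
      by (auto simp: overpartitions_def)
    have "set \<pi> \<subseteq> {..n} \<times> UNIV"
      using s by (force intro: member_le_sum_list)
    moreover have "length \<pi> \<le> sum_list (map fst \<pi>)"
      using pos by (induction \<pi>) auto
    ultimately show "\<pi> \<in> {\<pi>. set \<pi> \<subseteq> {..n} \<times> UNIV \<and> length \<pi> \<le> n}"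
      using s by simp
  qed
  show "finite {\<pi>. set \<pi> \<subseteq> {..n} \<times> (UNIV :: bool set) \<and> length \<pi> \<le> n}"
    by (rule finite_lists_length_le) simp
qed

end

theory Submission
  imports Defs "HOL-Computational_Algebra.Formal_Power_Series" "HOL-Real_Asymp.Real_Asymp"
begin

unbundle fps_syntax

text \<open>
  Toggling the overline of the first (largest) part \<open>m\<close> is a fixed-point-free involution on the
  overpartitions of \<open>n > 0\<close>. It preserves \<open>mex_hat\<close>, unless all of \<open>1, \<dots>, m - 1\<close> are overlined,
  when the two values are \<open>m\<close> and \<open>m + 1\<close>. So modulo 2 the sum counts the overpartitions whose part
  sizes are exactly \<open>1, \<dots>, m\<close>, all overlined, that is, the partitions of \<open>n\<close> without gaps. With
  the harmless signs \<open>(-1) ^ m\<close>, their generating function is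
  \<open>\<Sum>m. (-1) ^ m q ^ (m (m + 1) / 2) / (q; q)\<^sub>m = (q; q)\<^sub>\<infinity>\<close>, which by Euler's pentagonal number
  theorem (here in Shanks' finite form) is supported on the pentagonal numbers. These have density zero.
\<close>

section \<open>Parity of the mex sum\<close>

text \<open>The largest part \<open>m\<close> is kept as a parameter so that the sign
  \<open>(-1) ^ m\<close> can be attached to each family; for \<open>m = 0\<close> only the empty
  list qualifies.\<close>

definition gapfree :: "nat \<Rightarrow> nat \<Rightarrow> nat list set" where
  "gapfree m n = {xs. sorted_wrt (\<ge>) xs \<and> set xs = {1..m} \<and> sum_list xs = n}"

definition toggle :: "(nat \<times> bool) list \<Rightarrow> (nat \<times> bool) list" where
  "toggle \<pi> = (fst (hd \<pi>), \<not> snd (hd \<pi>)) # tl \<pi>"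

text \<open>For \<open>m > 0\<close> this means \<open>m \<le> mex_hat \<pi>\<close>.\<close>

definition overlined_below :: "nat \<Rightarrow> (nat \<times> bool) list \<Rightarrow> bool" where
  "overlined_below m \<pi> \<longleftrightarrow> (\<forall>i\<in>{1..<m}. (i, True) \<in> set \<pi>)"

definition fully_overlined :: "nat \<Rightarrow> nat \<Rightarrow> (nat \<times> bool) list set" where
  "fully_overlined m n = {\<pi> \<in> overpartitions n. fst ` set \<pi> = {1..m} \<and> (\<forall>i\<in>{1..m}. (i, True) \<in> set \<pi>)}"

text \<open>Only pairs of positions that involve the head are new, and for these the positional rule
  becomes a membership condition on the tail. The flag \<open>b\<close> is absent from the
  right-hand side, so toggling it preserves overpartitions.\<close>

lemma overpartitions_Cons:
  "(m, b) # \<pi> \<in> overpartitions n \<longleftrightarrow>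
     m > 0 \<and> m \<le> n \<and> \<pi> \<in> overpartitions (n - m) \<and> (\<forall>p\<in>set \<pi>. fst p \<le> m) \<and> (m, True) \<notin> set \<pi>"
proof -
  have "(\<forall>i j. i < j \<and> j < length ((m, b) # \<pi>) \<and> fst (((m, b) # \<pi>) ! i) = fst (((m, b) # \<pi>) ! j)
            \<longrightarrow> \<not> snd (((m, b) # \<pi>) ! j)) \<longleftrightarrow>
        (\<forall>i j. i < j \<and> j < length \<pi> \<and> fst (\<pi> ! i) = fst (\<pi> ! j) \<longrightarrow> \<not> snd (\<pi> ! j)) \<and>
        (m, True) \<notin> set \<pi>" (is "?L \<longleftrightarrow> ?R \<and> ?S")
  proof (intro iffI conjI)
    assume L: ?L
    show ?R
    proof (intro allI impI)
      fix i j assume "i < j \<and> j < length \<pi> \<and> fst (\<pi> ! i) = fst (\<pi> ! j)"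
      with L[rule_format, of "Suc i" "Suc j"] show "\<not> snd (\<pi> ! j)" by simp
    qed
    show ?S
    proof
      assume "(m, True) \<in> set \<pi>"
      then obtain j where "j < length \<pi>" "\<pi> ! j = (m, True)"
        by (auto simp: in_set_conv_nth)
      with L[rule_format, of 0 "Suc j"] show False by simp
    qed
  next
    assume R: "?R \<and> ?S"
    show ?L
    proof (intro allI impI)
      fix i j
      assume a: "i < j \<and> j < length ((m, b) # \<pi>) \<and> fst (((m, b) # \<pi>) ! i) = fst (((m, b) # \<pi>) ! j)"
      then obtain j' where j: "j = Suc j'" by (cases j) auto
      show "\<not> snd (((m, b) # \<pi>) ! j)"
      proof (cases i)
        case 0
        with a j have "j' < length \<pi>" "fst (\<pi> ! j') = m" by auto
        with R show ?thesis
          using nth_mem[of j' \<pi>] by (cases "\<pi> ! j'") (auto simp: j)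
      next
        case (Suc i')
        with a j R show ?thesis by auto
      qed
    qed
  qed
  then show ?thesis
    unfolding overpartitions_def by auto
qed

section \<open>Toggling the overline of the first part\<close>

lemma overpartitions_ConsE:
  assumes "\<pi> \<in> overpartitions n" "n > 0"
  obtains m b \<rho> where "\<pi> = (m, b) # \<rho>"
  using assms by (cases \<pi>) (auto simp: overpartitions_def)

lemma toggle_in_overpartitions:
  assumes "\<pi> \<in> overpartitions n" "n > 0"
  shows "toggle \<pi> \<in> overpartitions n"
proof -
  obtain m b \<rho> where "\<pi> = (m, b) # \<rho>"
    using assms by (rule overpartitions_ConsE)
  with assms(1) show ?thesis by (simp add: toggle_def overpartitions_Cons)
qed

lemma mex_hat_eqI:
  assumes "m > 0" "overlined_below m \<pi>" "(m, True) \<notin> set \<pi>"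
  shows "mex_hat \<pi> = m"
  unfolding mex_hat_def
proof (rule Least_equality)
  fix k assume k: "k > 0 \<and> (k, True) \<notin> set \<pi>"
  show "m \<le> k"
  proof (rule ccontr)
    assume "\<not> m \<le> k"
    with k have "k \<in> {1..<m}" by simp
    with assms(2) k show False by (auto simp: overlined_below_def)
  qed
qed (use assms in auto)

lemma even_mex_hat_toggle:
  assumes "\<pi> \<in> overpartitions n" "n > 0" "snd (hd \<pi>)"
  shows "even (mex_hat \<pi> + mex_hat (toggle \<pi>)) \<longleftrightarrow> \<not> overlined_below (fst (hd \<pi>)) \<pi>"
proof -
  obtain m b \<rho> where pi: "\<pi> = (m, b) # \<rho>"
    using assms(1,2) by (rule overpartitions_ConsE)
  have b: "b" using assms(3) pi by simp
  have m: "m > 0" "(m, True) \<notin> set \<rho>" "\<forall>p\<in>set \<rho>. fst p \<le> m"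
    using assms(1) by (auto simp: pi overpartitions_Cons)
  show ?thesis
  proof (cases "overlined_below m \<pi>")
    case True
    have *: "overlined_below m \<rho>"
      using True by (auto simp: overlined_below_def pi)
    have "mex_hat (toggle \<pi>) = m"
      using m * by (intro mex_hat_eqI) (auto simp: toggle_def pi b overlined_below_def)
    moreover have "mex_hat \<pi> = Suc m"
    proof (rule mex_hat_eqI)
      show "overlined_below (Suc m) \<pi>"
        using True b by (auto simp: overlined_below_def pi less_Suc_eq)
      \<comment> \<open>The head is a largest part, so \<open>Suc m\<close> does not occur at
        all.\<close>
      show "(Suc m, True) \<notin> set \<pi>"
        using m by (auto simp: pi)
    qed simp
    ultimately show ?thesis using True pi by simp
  next
    case False
    then obtain i where i: "i \<ge> 1" "i < m" "(i, True) \<notin> set \<pi>"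
      by (auto simp: overlined_below_def)
    \<comment> \<open>\<open>k\<close> is the value of \<open>mex_hat \<pi>\<close>. Since
      \<open>k \<le> i < m\<close>, changing the flag of the head, which has size \<open>m\<close>,
      leaves it unaffected.\<close>
    define k where "k = (LEAST k. k > 0 \<and> (k, True) \<notin> set \<pi>)"
    have k: "k > 0 \<and> (k, True) \<notin> set \<pi>"
      unfolding k_def by (rule LeastI[of _ i]) (use i in auto)
    have ki: "k \<le> i"
      unfolding k_def by (rule Least_le) (use i in auto)
    have "overlined_below k \<pi>"
      using not_less_Least[where P = "\<lambda>k. k > 0 \<and> (k, True) \<notin> set \<pi>"]
      unfolding overlined_below_def k_def by fastforce
    then have "overlined_below k (toggle \<pi>)"
      using ki i by (auto simp: overlined_below_def toggle_def pi)
    moreover have "(k, True) \<notin> set (toggle \<pi>)"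
      using k by (auto simp: toggle_def pi b)
    ultimately have "mex_hat (toggle \<pi>) = k"
      using k by (intro mex_hat_eqI) auto
    moreover have "mex_hat \<pi> = k"
      by (simp add: mex_hat_def k_def)
    ultimately show ?thesis using False pi by simp
  qed
qed

section \<open>Fully overlined overpartitions\<close>

lemma finite_fully_overlined: "finite (fully_overlined m n)"
  by (rule finite_subset[OF _ finite_overpartitions[of n]]) (auto simp: fully_overlined_def)

text \<open>The head is a largest part, so the set of sizes \<open>{1..m}\<close> forces it to have
  size \<open>m\<close>, and it is the only entry of size \<open>m\<close> that may be overlined. In
  particular \<open>\<pi>\<close> determines \<open>m\<close>.\<close>

lemma fully_overlined_iff:
  assumes "n > 0"
  shows "\<pi> \<in> fully_overlined m n \<longleftrightarrow>
    \<pi> \<in> overpartitions n \<and> snd (hd \<pi>) \<and> overlined_below (fst (hd \<pi>)) \<pi> \<and> m = fst (hd \<pi>)"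
    (is "?L \<longleftrightarrow> ?R")
proof
  assume L: ?L
  then obtain k b \<rho> where pi: "\<pi> = (k, b) # \<rho>"
    using assms unfolding fully_overlined_def by (blast elim: overpartitions_ConsE)
  have "(k, b) # \<rho> \<in> overpartitions n" using L by (simp add: fully_overlined_def pi)
  then have k: "\<forall>p\<in>set \<rho>. fst p \<le> k" "(k, True) \<notin> set \<rho>"
    by (auto simp: overpartitions_Cons)
  have im: "insert k (fst ` set \<rho>) = {1..m}" using L by (simp add: fully_overlined_def pi)
  then have "k \<in> {1..m}" by blast
  then have "m \<in> insert k (fst ` set \<rho>)" unfolding im by simp
  with k have "m \<le> k" by auto
  with \<open>k \<in> {1..m}\<close> have "m = k" by simp
  with \<open>k \<in> {1..m}\<close> L k show ?R
    by (auto simp: fully_overlined_def pi overlined_below_def)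
next
  assume R: ?R
  then obtain k b \<rho> where pi: "\<pi> = (k, b) # \<rho>"
    using assms by (blast elim: overpartitions_ConsE)
  have ov: "(k, b) # \<rho> \<in> overpartitions n" using R unfolding pi by blast
  then have k: "k > 0" "\<forall>p\<in>set \<rho>. fst p \<le> k" "\<forall>p\<in>set \<rho>. fst p > 0"
    by (auto simp: overpartitions_Cons) (auto simp: overpartitions_def)
  have all: "\<forall>i\<in>{1..k}. (i, True) \<in> set \<pi>"
    using R by (auto simp: overlined_below_def pi le_less)
  have "fst ` set \<pi> = {1..k}"
  proof
    show "fst ` set \<pi> \<subseteq> {1..k}" using k by (fastforce simp: pi Suc_le_eq)
    show "{1..k} \<subseteq> fst ` set \<pi>" using all by force
  qed
  moreover have "m = k" using R pi by simp
  ultimately show ?L using all R unfolding fully_overlined_def by blast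
qed

lemma even_sum_iff_even_card:
  fixes f :: "'a \<Rightarrow> nat"
  assumes "finite A"
  shows "even (sum f A) \<longleftrightarrow> even (card {x\<in>A. odd (f x)})"
  using assms by (simp add: even_sum_iff)

text \<open>Since \<open>toggle\<close> is its own inverse, it pairs the overpartitions with
  overlined head (\<open>A\<close>) with the others (\<open>B\<close>). The sum over a pair is odd
  exactly when its member in \<open>A\<close> is fully overlined.\<close>

lemma even_sigma_mex_hat_fully_overlined:
  assumes "n > 0"
  shows "even (sigma_mex_hat n) \<longleftrightarrow> even (\<Sum>m\<le>n. card (fully_overlined m n))"
proof -
  define A where "A = {\<pi> \<in> overpartitions n. snd (hd \<pi>)}"
  define B where "B = {\<pi> \<in> overpartitions n. \<not> snd (hd \<pi>)}"
  have fin: "finite A" "finite B"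
    using finite_overpartitions[of n] by (auto simp: A_def B_def)
  have toggle2: "toggle (toggle \<pi>) = \<pi>" if "\<pi> \<in> overpartitions n" for \<pi>
    using that assms by (elim overpartitions_ConsE) (auto simp: toggle_def)
  have snd_toggle: "snd (hd (toggle \<pi>)) \<longleftrightarrow> \<not> snd (hd \<pi>)" for \<pi>
    by (simp add: toggle_def)
  have bij: "bij_betw toggle A B"
    by (rule bij_betw_byWitness[of _ toggle])
       (use toggle_in_overpartitions assms toggle2 snd_toggle in \<open>auto simp: A_def B_def\<close>)
  have "sigma_mex_hat n = (\<Sum>\<pi>\<in>A \<union> B. mex_hat \<pi>)"
    using assms by (auto simp: sigma_mex_hat_def A_def B_def intro!: sum.cong)
  also have "\<dots> = (\<Sum>\<pi>\<in>A. mex_hat \<pi>) + (\<Sum>\<pi>\<in>B. mex_hat \<pi>)"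
    using fin by (intro sum.union_disjoint) (auto simp: A_def B_def)
  also have "(\<Sum>\<pi>\<in>B. mex_hat \<pi>) = (\<Sum>\<pi>\<in>A. mex_hat (toggle \<pi>))"
    by (rule sum.reindex_bij_betw[OF bij, symmetric])
  finally have "sigma_mex_hat n = (\<Sum>\<pi>\<in>A. mex_hat \<pi> + mex_hat (toggle \<pi>))"
    by (simp add: sum.distrib)
  then have "even (sigma_mex_hat n) \<longleftrightarrow>
      even (card {\<pi>\<in>A. odd (mex_hat \<pi> + mex_hat (toggle \<pi>))})"
    by (simp only: even_sum_iff_even_card[OF fin(1)])
  also have "{\<pi>\<in>A. odd (mex_hat \<pi> + mex_hat (toggle \<pi>))} = (\<Union>m\<le>n. fully_overlined m n)"
    (is "?L = ?R")
  proof -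
    have le: "fst (hd \<pi>) \<le> n" if pi: "\<pi> \<in> overpartitions n" for \<pi>
    proof -
      obtain m b \<rho> where "\<pi> = (m, b) # \<rho>"
        by (rule overpartitions_ConsE[OF pi assms])
      with pi show ?thesis by (simp add: overpartitions_Cons)
    qed
    have "\<pi> \<in> ?L \<longleftrightarrow> \<pi> \<in> A \<and> overlined_below (fst (hd \<pi>)) \<pi>" for \<pi>
      using even_mex_hat_toggle[OF _ assms] unfolding A_def mem_Collect_eq by blast
    moreover have "\<pi> \<in> ?R \<longleftrightarrow> \<pi> \<in> A \<and> overlined_below (fst (hd \<pi>)) \<pi>" for \<pi>
      using fully_overlined_iff[OF assms] le by (auto simp: A_def)
    ultimately show ?thesis by blast
  qed
  \<comment> \<open>The union is disjoint because \<open>m\<close> is the size of the head.\<close>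
  also have "card (\<Union>m\<le>n. fully_overlined m n) = (\<Sum>m\<le>n. card (fully_overlined m n))"
    by (rule card_UN_disjoint)
       (use finite_fully_overlined fully_overlined_iff[OF assms] in auto)
  finally show ?thesis .
qed

text \<open>Each occurring size is overlined somewhere, and only its first occurrence may be. Hence
  the flags can be recovered from the sizes, which makes erasing them injective.\<close>

lemma snd_nth_fully_overlined:
  assumes "\<pi> \<in> fully_overlined m n" "j < length \<pi>"
  shows "snd (\<pi> ! j) \<longleftrightarrow> (\<forall>i<j. fst (\<pi> ! i) \<noteq> fst (\<pi> ! j))"
proof
  have ov: "\<not> snd (\<pi> ! j)" if "i < j" "j < length \<pi>" "fst (\<pi> ! i) = fst (\<pi> ! j)" for i j
    using assms that unfolding fully_overlined_def overpartitions_def by auto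
  show "snd (\<pi> ! j) \<Longrightarrow> \<forall>i<j. fst (\<pi> ! i) \<noteq> fst (\<pi> ! j)"
    using ov assms(2) by blast
  assume first: "\<forall>i<j. fst (\<pi> ! i) \<noteq> fst (\<pi> ! j)"
  have "fst (\<pi> ! j) \<in> {1..m}"
    using assms nth_mem[OF assms(2)] unfolding fully_overlined_def by blast
  then have "(fst (\<pi> ! j), True) \<in> set \<pi>"
    using assms(1) unfolding fully_overlined_def by blast
  then obtain k where k: "k < length \<pi>" "\<pi> ! k = (fst (\<pi> ! j), True)"
    by (auto simp: in_set_conv_nth)
  then have "\<not> k < j" using first by auto
  moreover have "\<not> j < k" using ov[of j k] k by auto
  ultimately have "k = j" by simp
  with k(2) show "snd (\<pi> ! j)" by (metis snd_conv)
qed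

lemma bij_betw_fully_overlined_gapfree:
  "bij_betw (map fst) (fully_overlined m n) (gapfree m n)"
  unfolding bij_betw_def
proof
  show "inj_on (map fst) (fully_overlined m n)"
  proof (rule inj_onI)
    fix \<pi> \<rho>
    assume a: "\<pi> \<in> fully_overlined m n" "\<rho> \<in> fully_overlined m n" "map fst \<pi> = map fst \<rho>"
    have len: "length \<pi> = length \<rho>" using a(3) by (rule map_eq_imp_length_eq)
    have f: "fst (\<pi> ! j) = fst (\<rho> ! j)" if "j < length \<pi>" for j
      using a(3) that len by (metis nth_map)
    show "\<pi> = \<rho>"
    proof (rule nth_equalityI[OF len])
      fix j assume j: "j < length \<pi>"
      have "snd (\<pi> ! j) = snd (\<rho> ! j)"
        using snd_nth_fully_overlined[OF a(1) j] snd_nth_fully_overlined[OF a(2), of j] j len f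
        by auto
      with f[OF j] show "\<pi> ! j = \<rho> ! j" by (simp add: prod_eq_iff)
    qed
  qed
  show "map fst ` fully_overlined m n = gapfree m n"
  proof
    show "map fst ` fully_overlined m n \<subseteq> gapfree m n"
      by (auto simp: fully_overlined_def gapfree_def overpartitions_def sorted_wrt_map
            simp flip: image_set)
    show "gapfree m n \<subseteq> map fst ` fully_overlined m n"
    proof
      fix xs assume xs: "xs \<in> gapfree m n"
      \<comment> \<open>The preimage overlines precisely the first occurrence of each size.\<close>
      define \<pi> where "\<pi> = map (\<lambda>j. (xs ! j, \<forall>i<j. xs ! i \<noteq> xs ! j)) [0..<length xs]"
      have m: "map fst \<pi> = xs" by (auto simp: \<pi>_def intro: nth_equalityI)
      have st: "fst ` set \<pi> = set xs" by (metis m set_map)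
      have so: "sorted_wrt (\<lambda>p q. fst p \<ge> fst q) \<pi>"
        using xs by (simp add: gapfree_def sorted_wrt_map flip: m)
      have "(i, True) \<in> set \<pi>" if "i \<in> {1..m}" for i
      proof -
        have ex: "\<exists>j. j < length xs \<and> xs ! j = i"
          using xs that by (auto simp: gapfree_def in_set_conv_nth)
        define j where "j = (LEAST j. j < length xs \<and> xs ! j = i)"
        have j: "j < length xs" "xs ! j = i"
          using LeastI_ex[OF ex] by (auto simp: j_def)
        have "xs ! k \<noteq> i" if "k < j" for k
          using not_less_Least[OF that[unfolded j_def]] that j(1) by simp
        then have "\<pi> ! j = (i, True)" using j by (simp add: \<pi>_def)
        moreover have "j < length \<pi>" using j(1) by (simp add: \<pi>_def)
        ultimately show ?thesis by (metis nth_mem)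
      qed
      moreover have "\<forall>p\<in>set \<pi>. fst p > 0"
      proof
        fix p assume "p \<in> set \<pi>"
        then have "fst p \<in> set xs" using st by blast
        with xs show "fst p > 0" by (simp add: gapfree_def)
      qed
      moreover have "\<not> snd (\<pi> ! j)" if "i < j" "j < length \<pi>" "fst (\<pi> ! i) = fst (\<pi> ! j)" for i j
        using that by (auto simp: \<pi>_def)
      ultimately have "\<pi> \<in> fully_overlined m n"
        using xs st so m by (auto simp: fully_overlined_def overpartitions_def gapfree_def)
      with m show "xs \<in> map fst ` fully_overlined m n" by (metis imageI)
    qed
  qed
qed

lemma finite_gapfree: "finite (gapfree m n)"
  using bij_betw_finite[OF bij_betw_fully_overlined_gapfree] finite_fully_overlined by blast

text \<open>Signs do not affect parity. They turn the count into the coefficient of a series that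
  Shanks' identity evaluates.\<close>

lemma even_sigma_mex_hat_gapfree:
  assumes "n > 0"
  shows "even (sigma_mex_hat n) \<longleftrightarrow> even (\<Sum>m\<le>n. (- 1) ^ m * int (card (gapfree m n)))"
proof -
  have "card (fully_overlined m n) = card (gapfree m n)" for m
    by (rule bij_betw_same_card[OF bij_betw_fully_overlined_gapfree])
  then have "even (sigma_mex_hat n) \<longleftrightarrow> even (\<Sum>m\<le>n. card (gapfree m n))"
    using even_sigma_mex_hat_fully_overlined[OF assms] by simp
  also have "\<dots> \<longleftrightarrow> even (\<Sum>m\<le>n. (- 1) ^ m * int (card (gapfree m n)))"
    by (simp add: even_sum_iff)
  finally show ?thesis .
qed

section \<open>The generating function of gap-free partitions\<close>

lemma gapfree_0: "gapfree 0 n = (if n = 0 then {[]} else {})"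
  by (auto simp: gapfree_def)

text \<open>Remove one copy of the largest part \<open>Suc m\<close>: either another copy remains,
  or the remaining sizes are exactly \<open>{1..m}\<close>.\<close>

lemma gapfree_Suc:
  "gapfree (Suc m) n =
     (if n < Suc m then {} else (#) (Suc m) ` (gapfree (Suc m) (n - Suc m) \<union> gapfree m (n - Suc m)))"
proof -
  have tail: "x = Suc m \<and> (set xs = {1..Suc m} \<or> set xs = {1..m})"
    if "insert x (set xs) = {1..Suc m}" "\<forall>y\<in>set xs. y \<le> x" for x and xs :: "nat list"
  proof -
    have "Suc m \<in> insert x (set xs)" "x \<in> {1..Suc m}" using that(1) by auto
    then have x: "x = Suc m" using that(2) by auto
    show ?thesis
    proof (cases "x \<in> set xs")
      case True
      then show ?thesis using that(1) x by (simp add: insert_absorb)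
    next
      case False
      then have "set xs = {1..Suc m} - {Suc m}" using that(1) x by blast
      also have "\<dots> = {1..m}" by auto
      finally show ?thesis using x by simp
    qed
  qed
  have "xs \<in> gapfree (Suc m) n \<longleftrightarrow>
     Suc m \<le> n \<and> xs \<in> (#) (Suc m) ` (gapfree (Suc m) (n - Suc m) \<union> gapfree m (n - Suc m))" for xs
  proof
    assume xs: "xs \<in> gapfree (Suc m) n"
    then obtain x ys where [simp]: "xs = x # ys" by (cases xs) (auto simp: gapfree_def)
    have "x = Suc m \<and> (set ys = {1..Suc m} \<or> set ys = {1..m})"
      by (rule tail) (use xs in \<open>auto simp: gapfree_def\<close>)
    with xs show "Suc m \<le> n \<and> xs \<in> (#) (Suc m) ` (gapfree (Suc m) (n - Suc m) \<union> gapfree m (n - Suc m))"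
      by (auto simp: gapfree_def)
  next
    assume "Suc m \<le> n \<and> xs \<in> (#) (Suc m) ` (gapfree (Suc m) (n - Suc m) \<union> gapfree m (n - Suc m))"
    then obtain ys where ys: "xs = Suc m # ys" "Suc m \<le> n"
      "ys \<in> gapfree (Suc m) (n - Suc m) \<union> gapfree m (n - Suc m)" by blast
    then have "set ys = {1..Suc m} \<or> set ys = {1..m}"
      by (auto simp: gapfree_def)
    then have "insert (Suc m) (set ys) = {1..Suc m}"
      by (auto simp: atLeastAtMostSuc_conv)
    moreover from this have "\<forall>y\<in>set ys. y \<le> Suc m"
      by (metis atLeastAtMost_iff insertI2)
    ultimately show "xs \<in> gapfree (Suc m) n"
      using ys unfolding gapfree_def by auto
  qed
  then show ?thesis by (simp add: set_eq_iff)
qed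

lemma card_gapfree_Suc:
  "card (gapfree (Suc m) n) =
     (if n < Suc m then 0 else card (gapfree (Suc m) (n - Suc m)) + card (gapfree m (n - Suc m)))"
proof -
  have "gapfree (Suc m) k \<inter> gapfree m k = {}" for k
    by (auto simp: gapfree_def)
  then have "card (gapfree (Suc m) k \<union> gapfree m k) = card (gapfree (Suc m) k) + card (gapfree m k)" for k
    by (intro card_Un_disjoint finite_gapfree)
  then show ?thesis
    by (subst gapfree_Suc) (auto simp: card_image)
qed

definition gapfree_fps :: "nat \<Rightarrow> int fps" where
  "gapfree_fps m = Abs_fps (\<lambda>n. int (card (gapfree m n)))"

lemma gapfree_fps_0: "gapfree_fps 0 = 1"
  by (rule fps_ext) (simp add: gapfree_fps_def gapfree_0)

lemma gapfree_fps_Suc: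
  "(1 - fps_X ^ Suc m) * gapfree_fps (Suc m) = fps_X ^ Suc m * gapfree_fps m"
proof -
  have "gapfree_fps (Suc m) = fps_X ^ Suc m * (gapfree_fps (Suc m) + gapfree_fps m)"
  proof (rule fps_ext)
    fix n
    show "gapfree_fps (Suc m) $ n = (fps_X ^ Suc m * (gapfree_fps (Suc m) + gapfree_fps m)) $ n"
      \<comment> \<open>The shift by \<open>fps_X ^ Suc m\<close> gives coefficient 0 below
        \<open>Suc m\<close>, which matches the case \<open>n < Suc m\<close> of the recursion for
        the cardinalities.\<close>
      unfolding fps_X_power_mult_nth
      by (simp add: gapfree_fps_def card_gapfree_Suc[of m n])
  qed
  then show ?thesis by (simp add: algebra_simps)
qed

section \<open>Shanks' identity\<close>

text \<open>
  Solving the recursion gives \<open>G s = q ^ (s (s + 1) / 2) / (q; q)\<^sub>s\<close>; keeping it implicit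
  avoids division.
\<close>

locale shanks =
  fixes q :: "'a :: comm_ring_1" and G :: "nat \<Rightarrow> 'a"
  assumes G_0: "G 0 = 1"
    and G_Suc: "(1 - q ^ Suc s) * G (Suc s) = q ^ Suc s * G s"
begin

text \<open>The finite product \<open>(q; q)_j\<close>.\<close>

definition qpoch :: "nat \<Rightarrow> 'a" where
  "qpoch j = (\<Prod>i<j. 1 - q ^ Suc i)"

text \<open>A truncation of Euler's series for the infinite product of \<open>1 - q ^ i\<close> over
  \<open>i > j\<close>; formally, \<open>qpoch j * S j N\<close> thus approximates
  \<open>(q; q)_\<infinity>\<close> for every \<open>j\<close>.\<close>

definition S :: "nat \<Rightarrow> nat \<Rightarrow> 'a" where
  "S j N = (\<Sum>s\<le>N. (- 1) ^ s * q ^ (s * j) * G s)"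

lemma qpoch_Suc: "qpoch (Suc j) = qpoch j * (1 - q ^ Suc j)"
  by (simp add: qpoch_def)

lemma qpoch_G: "qpoch s * G s = q ^ (\<Sum>i\<le>s. i)"
proof (induction s)
  case 0
  then show ?case by (simp add: qpoch_def G_0)
next
  case (Suc s)
  have "qpoch (Suc s) * G (Suc s) = qpoch s * ((1 - q ^ Suc s) * G (Suc s))"
    by (simp only: qpoch_Suc mult.assoc)
  also have "\<dots> = q ^ Suc s * (qpoch s * G s)"
    by (simp only: G_Suc mult.left_commute)
  also have "\<dots> = q ^ (\<Sum>i\<le>Suc s. i)"
    by (simp only: Suc sum.atMost_Suc power_add mult.commute[of "q ^ Suc s"])
  finally show ?case .
qed

text \<open>For the infinite product that \<open>S j N\<close> truncates, passing from
  \<open>j\<close> to \<open>Suc j\<close> strips the factor \<open>1 - q ^ Suc j\<close>. The last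
  term is the exact error of truncation at \<open>N\<close>.\<close>

lemma S_step:
  "S j N = (1 - q ^ Suc j) * S (Suc j) N + (- 1) ^ N * q ^ (Suc N * Suc j) * G N"
proof (induction N)
  case 0
  then show ?case by (simp add: S_def G_0)
next
  case (Suc N)
  let ?e = "(- 1) ^ Suc N :: 'a" and ?a = "q ^ (Suc N * j)"
  have e: "(- 1) ^ N = - ?e" by simp
  have p1: "q ^ (Suc N * Suc j) = ?a * q ^ Suc N"
    by (simp only: mult_Suc_right power_add mult.commute)
  have p2: "q ^ (Suc (Suc N) * Suc j) = q ^ Suc j * (?a * q ^ Suc N)"
    by (simp only: mult_Suc[of "Suc N"] power_add p1)
  have "S j (Suc N) = S j N + ?e * ?a * G (Suc N)"
    by (simp only: S_def sum.atMost_Suc)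
  also have "S j N = (1 - q ^ Suc j) * S (Suc j) N - ?e * ?a * (q ^ Suc N * G N)"
    unfolding Suc e p1 by (simp add: algebra_simps)
  \<comment> \<open>The recursion rewrites the old error in terms of \<open>G (Suc N)\<close>.
    Together with the new summand of \<open>S j\<close> it leaves
    \<open>?e * ?a * q ^ Suc N * G (Suc N)\<close>, which splits into \<open>1 - q ^ Suc j\<close>
    times the new summand of \<open>S (Suc j)\<close> plus the new error.\<close>
  also have "q ^ Suc N * G N = (1 - q ^ Suc N) * G (Suc N)"
    by (rule G_Suc[symmetric])
  also have "(1 - q ^ Suc j) * S (Suc j) N - ?e * ?a * ((1 - q ^ Suc N) * G (Suc N)) + ?e * ?a * G (Suc N)
     = (1 - q ^ Suc j) * (S (Suc j) N + ?e * (?a * q ^ Suc N) * G (Suc N))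
       + ?e * (q ^ Suc j * (?a * q ^ Suc N)) * G (Suc N)"
    by (simp only: algebra_simps mult_1_left)
  also have "S (Suc j) N + ?e * (?a * q ^ Suc N) * G (Suc N) = S (Suc j) (Suc N)"
    by (simp only: S_def sum.atMost_Suc p1)
  finally show ?case by (simp only: p2)
qed

text \<open>The product \<open>qpoch j * S j N\<close> does not depend on \<open>j\<close> up to a
  multiple of \<open>q ^ Suc N\<close>.\<close>

lemma qpoch_S_step:
  "qpoch j * S j N =
     qpoch (Suc j) * S (Suc j) N + q ^ (Suc N * Suc j) * ((- 1) ^ N * qpoch j * G N)"
  by (subst S_step) (simp only: qpoch_Suc algebra_simps)

text \<open>Go from \<open>(N, N)\<close> to \<open>(N, Suc N)\<close> by adding one summand, then
  to \<open>(Suc N, Suc N)\<close> by \<open>qpoch_S_step\<close>. The result gains the two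
  pentagonal powers of index \<open>k = Suc N\<close>, with exponents \<open>k (3 k - 1) / 2\<close>
  and \<open>k (3 k + 1) / 2\<close>.\<close>

lemma qpoch_S_diag_Suc:
  "qpoch (Suc N) * S (Suc N) (Suc N) =
     qpoch N * S N N + (- 1) ^ Suc N * (q ^ ((\<Sum>i\<le>Suc N. i) + Suc N * N) * (1 + q ^ Suc N))"
proof -
  let ?M = "Suc N" and ?e = "(- 1) ^ Suc N :: 'a" and ?g = "qpoch N * G (Suc N)"
  have "qpoch N * S N ?M = qpoch N * S N N + ?e * q ^ (?M * N) * ?g"
    by (simp only: S_def sum.atMost_Suc algebra_simps)
  then have "qpoch ?M * S ?M ?M =
      qpoch N * S N N + ?e * q ^ (?M * N) * ?g - q ^ (Suc ?M * ?M) * (?e * ?g)"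
    using qpoch_S_step[of N ?M] by (simp add: algebra_simps)
  \<comment> \<open>With this, the two corrections share the factor
    \<open>1 - q ^ (2 * ?M) = (1 - q ^ ?M) * (1 + q ^ ?M)\<close>. Its first factor completes
    \<open>qpoch N\<close> to \<open>qpoch ?M\<close>, so that \<open>qpoch_G\<close>
    applies.\<close>
  also have "q ^ (Suc ?M * ?M) = q ^ (?M * N) * (q ^ ?M * q ^ ?M)"
    by (simp add: algebra_simps flip: power_add)
  also have "qpoch N * S N N + ?e * q ^ (?M * N) * ?g - q ^ (?M * N) * (q ^ ?M * q ^ ?M) * (?e * ?g)
      = qpoch N * S N N + ?e * (qpoch N * (1 - q ^ ?M) * G ?M * q ^ (?M * N) * (1 + q ^ ?M))"
    by (simp only: algebra_simps mult_1_left)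
  also have "qpoch N * (1 - q ^ ?M) * G ?M = q ^ (\<Sum>i\<le>?M. i)"
    by (simp only: qpoch_G flip: qpoch_Suc)
  finally show ?thesis by (simp only: power_add mult.assoc)
qed

end

section \<open>Vanishing of the signed count off the pentagonal numbers\<close>

interpretation gapfree: shanks fps_X gapfree_fps
  by standard (fact gapfree_fps_0, fact gapfree_fps_Suc)

text \<open>Each change of \<open>j\<close> costs a multiple of
  \<open>fps_X ^ (Suc N * Suc j)\<close>, invisible in the coefficients up to
  \<open>N\<close>.\<close>

lemma fps_nth_gapfree_S:
  assumes "n \<le> N"
  shows "(gapfree.qpoch j * gapfree.S j N) $ n = gapfree.S 0 N $ n"
proof (induction j)
  case 0
  then show ?case by (simp add: gapfree.qpoch_def)
next
  case (Suc j)
  have "n < Suc N * Suc j" using assms by simp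
  then show ?case
    using Suc gapfree.qpoch_S_step[of j N] by (simp only: fps_add_nth fps_X_power_mult_nth) simp
qed

text \<open>The numbers \<open>k (3 k - 1) / 2\<close> and \<open>k (3 k + 1) / 2\<close>.\<close>

definition pentagonal :: "nat set" where
  "pentagonal = (\<Union>k. {(\<Sum>i\<le>k. i) + k * (k - 1), (\<Sum>i\<le>k. i) + k * k})"

lemma triangle_in_pentagonal:
  "(\<Sum>i\<le>k. i) + k * (k - 1) \<in> pentagonal" "(\<Sum>i\<le>k. i) + k * k \<in> pentagonal"
  unfolding pentagonal_def by blast+

lemma zero_in_pentagonal: "0 \<in> pentagonal"
  unfolding pentagonal_def by (intro UN_I[of 0]) simp_all

lemma fps_nth_minus_one_power_mult:
  fixes f :: "'a :: comm_ring_1 fps"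
  shows "((- 1) ^ k * f) $ n = (- 1) ^ k * f $ n"
  by (induction k) (simp_all add: mult.assoc)

text \<open>The diagonal starts at 1, whose exponent 0 is pentagonal, and each step along it adds
  only two powers with pentagonal exponents.\<close>

lemma fps_nth_gapfree_diag:
  assumes "n \<notin> pentagonal"
  shows "(gapfree.qpoch N * gapfree.S N N) $ n = 0"
proof (induction N)
  case 0
  have "n \<noteq> 0" using assms zero_in_pentagonal by metis
  then show ?case by (simp add: gapfree.qpoch_def gapfree.S_def gapfree_fps_0)
next
  case (Suc N)
  define t where "t = (\<Sum>i\<le>Suc N. i) + Suc N * N"
  have "t \<in> pentagonal" "t + Suc N \<in> pentagonal"
    using triangle_in_pentagonal[of "Suc N"] by (simp_all add: t_def add_ac)
  then have n: "n \<noteq> t" "n \<noteq> t + Suc N"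
    using assms by blast+
  have "fps_X ^ t * (1 + fps_X ^ Suc N) = (fps_X ^ t + fps_X ^ (t + Suc N) :: int fps)"
    by (simp only: distrib_left mult_1_right power_add)
  then have "(fps_X ^ t * (1 + fps_X ^ Suc N)) $ n = (0 :: int)"
    using n by (simp only: fps_add_nth fps_X_power_nth if_False add_0)
  then show ?case
    by (simp only: gapfree.qpoch_S_diag_Suc fps_add_nth Suc fps_nth_minus_one_power_mult
          mult_zero_right add_0 flip: t_def)
qed

lemma even_sigma_mex_hat:
  assumes "n \<notin> pentagonal"
  shows "even (sigma_mex_hat n)"
proof -
  have n: "n > 0"
    using assms zero_in_pentagonal by (cases n) auto
  have "(\<Sum>m\<le>n. (- 1) ^ m * int (card (gapfree m n))) = gapfree.S 0 n $ n"
    by (simp add: gapfree.S_def gapfree_fps_def fps_sum_nth fps_nth_minus_one_power_mult)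
  \<comment> \<open>Moving \<open>j\<close> from 0 to \<open>n\<close> keeps the coefficient at
    \<open>n\<close> and reaches the diagonal.\<close>
  also have "\<dots> = 0"
    using fps_nth_gapfree_S[of n n n] fps_nth_gapfree_diag[OF assms] by simp
  finally show ?thesis
    using even_sigma_mex_hat_gapfree[OF n] by simp
qed

section \<open>Density\<close>

text \<open>Both pentagonal numbers of index \<open>k\<close> are at least \<open>k * k\<close>, so
  only indices from 0 to the floor of \<open>sqrt X\<close> count, with at most two numbers
  each.\<close>

lemma card_pentagonal_le:
  assumes "X \<ge> 0"
  shows "real (card {n \<in> pentagonal. real n \<le> X}) \<le> 2 * (sqrt X + 1)"
proof -
  let ?f = "\<lambda>k::nat. (\<Sum>i\<le>k. i) + k * (k - 1)" and ?g = "\<lambda>k::nat. (\<Sum>i\<le>k. i) + k * k"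
  define K where "K = nat \<lfloor>sqrt X\<rfloor>"
  have tri: "k * k \<le> (\<Sum>i\<le>k. i) + k * (k - 1)" for k :: nat
    by (cases k) simp_all
  have bound: "k \<le> K" if "real n \<le> X" "k * k \<le> n" for k n :: nat
  proof -
    have "real k ^ 2 \<le> X"
      using that of_nat_mono[OF that(2), where 'a = real] by (simp add: power2_eq_square)
    then have "real k \<le> sqrt X" by (rule real_le_rsqrt)
    then show ?thesis by (simp add: K_def le_nat_floor)
  qed
  have "{n \<in> pentagonal. real n \<le> X} \<subseteq> ?f ` {..K} \<union> ?g ` {..K}"
  proof
    fix n assume n: "n \<in> {n \<in> pentagonal. real n \<le> X}"
    then obtain k where k: "n = ?f k \<or> n = ?g k" by (auto simp: pentagonal_def)
    have "k * k \<le> n" using k tri[of k] by auto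
    then have "k \<le> K" using bound n by blast
    with k show "n \<in> ?f ` {..K} \<union> ?g ` {..K}" by blast
  qed
  then have "card {n \<in> pentagonal. real n \<le> X} \<le> card (?f ` {..K} \<union> ?g ` {..K})"
    by (intro card_mono) auto
  also have "\<dots> \<le> card (?f ` {..K}) + card (?g ` {..K})" by (rule card_Un_le)
  also have "\<dots> \<le> 2 * Suc K"
    using card_image_le[of "{..K}" ?f] card_image_le[of "{..K}" ?g] by simp
  finally have "real (card {n \<in> pentagonal. real n \<le> X}) \<le> 2 * (real K + 1)" by simp
  also have "real K \<le> sqrt X" using assms by (simp add: K_def)
  finally show ?thesis by simp
qed

theorem theorem1p3:
  shows "((\<lambda>X::real. real (card {n::nat. real n \<le> X \<and> [sigma_mex_hat n = 0] (mod 2)}) / X)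
           \<longlongrightarrow> 1) at_top"
proof -
  let ?E = "\<lambda>X::real. {n::nat. real n \<le> X \<and> [sigma_mex_hat n = 0] (mod 2)}"
  let ?P = "\<lambda>X::real. {n \<in> pentagonal. real n \<le> X}"
  have *: "X - 2 * (sqrt X + 1) \<le> real (card (?E X)) \<and> real (card (?E X)) \<le> X + 1"
    if "X \<ge> 0" for X :: real
  proof -
    have all: "{n. real n \<le> X} = {..nat \<lfloor>X\<rfloor>}"
      using that by (auto simp: le_nat_floor) (metis of_nat_floor of_nat_mono order_trans)
    then have fin: "finite {n. real n \<le> X}" by simp
    \<comment> \<open>There are \<open>\<lfloor>X\<rfloor> + 1\<close> such numbers, as 0 is counted
      too.\<close>
    have card: "X \<le> real (card {n. real n \<le> X})" "real (card {n. real n \<le> X}) \<le> X + 1"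
      using that unfolding all by (simp_all, linarith+)
    \<comment> \<open>The odd value at \<open>n = 0\<close> does no harm: 0 is pentagonal.\<close>
    have "{n. real n \<le> X} \<subseteq> ?E X \<union> ?P X"
      using even_sigma_mex_hat by (auto simp: cong_0_iff)
    then have "card {n. real n \<le> X} \<le> card (?E X \<union> ?P X)"
      by (intro card_mono) (auto intro: finite_subset[OF _ fin])
    also have "\<dots> \<le> card (?E X) + card (?P X)" by (rule card_Un_le)
    finally have "X - real (card (?P X)) \<le> real (card (?E X))" using card by linarith
    moreover have "card (?E X) \<le> card {n. real n \<le> X}"
      by (rule card_mono[OF fin]) auto
    ultimately show ?thesis using card card_pentagonal_le[OF that] by linarith
  qed
  show ?thesis
  \<comment> \<open>Both bounds tend to 1, because \<open>sqrt X / X\<close> tends to 0.\<close>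
  proof (rule tendsto_sandwich)
    show "\<forall>\<^sub>F X in at_top. (X - 2 * (sqrt X + 1)) / X \<le> real (card (?E X)) / X"
      using eventually_gt_at_top[of 0] by eventually_elim (use * in \<open>simp add: divide_right_mono\<close>)
    show "\<forall>\<^sub>F X in at_top. real (card (?E X)) / X \<le> (X + 1) / X"
      using eventually_gt_at_top[of 0] by eventually_elim (use * in \<open>simp add: divide_right_mono\<close>)
  qed real_asymp+
qed

end
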